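(* There exist an adaptive randomized algorithm and an adaptive deterministic algorithm that solve the Graph Reconstruction problem with a CC oracle using $\mathcal{O}(k^2\log n)$ and $\mathcal{O}(k^3\log n)$ CC queries, respectively, where $n$ is the number of vertices and $k$ the treewidth of the hidden graph ($k$ not given to the algorithms). The algorithms use $\mathcal{O}(\log k)$ rounds of adaptivity. The output of the randomized algorithm is correct with high probability.
   Context: Graph Reconstruction (GR): an unknown ("hidden") simple undirected graph $G=(V,E)$ on a known vertex set $V$ with $|V|=n$ is to be determined, i.e. the algorithm must output $E$. A CC oracle, on query $S\subseteq V$, returns the partition of $S$ into the vertex sets of the connected components of the induced subgraph $G[S]$; complexity is the number of queries. An algorithm with $r$ rounds of adaptivity constructs $r$ successive sets of queries, where queries in the $i$-th set may depend on answers to queries in earlier sets. "Correct with high probability" means the output equals the hidden graph with probability tending to $1$ as $n\to\infty$. *)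

theory Defs
  imports "HOL-Probability.Probability"
begin

subsection \<open>Simple graphs\<close>

definition simple_graph :: "'a set \<Rightarrow> 'a set set \<Rightarrow> bool" where
  "simple_graph V E \<longleftrightarrow> finite V \<and> E \<subseteq> {{u, v} |u v. u \<in> V \<and> v \<in> V \<and> u \<noteq> v}"

definition induced_adj :: "'a set set \<Rightarrow> 'a set \<Rightarrow> ('a \<times> 'a) set" where
  "induced_adj E S = {(u, v). u \<in> S \<and> v \<in> S \<and> {u, v} \<in> E}"

definition induces_connected :: "'a set set \<Rightarrow> 'a set \<Rightarrow> bool" where
  "induces_connected E S \<longleftrightarrow> (\<forall>u\<in>S. \<forall>v\<in>S. (u, v) \<in> (induced_adj E S)\<^sup>*)"

definition is_cycle :: "'a set set \<Rightarrow> 'a list \<Rightarrow> bool" where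
  "is_cycle E xs \<longleftrightarrow> length xs \<ge> 3 \<and> distinct xs \<and>
     (\<forall>i<length xs. {xs ! i, xs ! ((i + 1) mod length xs)} \<in> E)"

definition is_tree :: "'a set \<Rightarrow> 'a set set \<Rightarrow> bool" where
  "is_tree I F \<longleftrightarrow> simple_graph I F \<and> I \<noteq> {} \<and> induces_connected F I \<and> (\<nexists>xs. is_cycle F xs)"


subsection \<open>Treewidth\<close>

text \<open>The nodes of the (finite) decomposition tree are taken to be natural numbers.\<close>

definition tree_decomposition ::
    "'a set \<Rightarrow> 'a set set \<Rightarrow> nat set \<Rightarrow> nat set set \<Rightarrow> (nat \<Rightarrow> 'a set) \<Rightarrow> bool" where
  "tree_decomposition V E I F B \<longleftrightarrow>
     is_tree I F \<and>
     (\<Union>i\<in>I. B i) = V \<and>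
     (\<forall>e\<in>E. \<exists>i\<in>I. e \<subseteq> B i) \<and>
     (\<forall>v\<in>V. induces_connected F {i \<in> I. v \<in> B i})"

text \<open>Subtraction on the naturals truncates only if all bags are empty, so the graph without
  vertices gets treewidth 0 instead of -1.\<close>

definition width :: "nat set \<Rightarrow> (nat \<Rightarrow> 'a set) \<Rightarrow> nat" where
  "width I B = Max ((\<lambda>i. card (B i)) ` I) - 1"

definition treewidth :: "'a set \<Rightarrow> 'a set set \<Rightarrow> nat" where
  "treewidth V E = (LEAST w. \<exists>I F B. tree_decomposition V E I F B \<and> width I B = w)"

lemma tree_decomposition_trivial:
  assumes "simple_graph V E"
  shows "tree_decomposition V E {0} {} (\<lambda>_. V)"
proof -
  have "\<not> is_cycle ({} :: nat set set) xs" for xs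
    unfolding is_cycle_def by (cases xs) auto
  then show ?thesis
    using assms
    by (auto simp: tree_decomposition_def is_tree_def simple_graph_def induces_connected_def)
qed


subsection \<open>The connected-components oracle and query strategies\<close>

definition cc_oracle :: "'a set set \<Rightarrow> 'a set \<Rightarrow> 'a set set" where
  "cc_oracle E S = S // {(u, v). u \<in> S \<and> v \<in> S \<and> (u, v) \<in> (induced_adj E S)\<^sup>*}"

text \<open>A deterministic adaptive strategy. A node \<open>Round qs next\<close> submits the queries \<open>qs\<close>
  simultaneously; \<open>next\<close> receives the list of their answers, in the same order, and yields the
  strategy for the remaining rounds. Hence a query depends only on answers of earlier rounds, and
  every strategy stops after finitely many queries. A randomized strategy is a probability
  distribution over deterministic ones.\<close>

datatype 'a strategy =
    Output "'a set set"
  | Round "'a set list" "'a set set list \<Rightarrow> 'a strategy"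

primrec result :: "('a set \<Rightarrow> 'a set set) \<Rightarrow> 'a strategy \<Rightarrow> 'a set set" where
  "result orc (Output E) = E"
| "result orc (Round qs next) = result orc (next (map orc qs))"

primrec queries :: "('a set \<Rightarrow> 'a set set) \<Rightarrow> 'a strategy \<Rightarrow> 'a set list" where
  "queries orc (Output E) = []"
| "queries orc (Round qs next) = qs @ queries orc (next (map orc qs))"

primrec rounds :: "('a set \<Rightarrow> 'a set set) \<Rightarrow> 'a strategy \<Rightarrow> nat" where
  "rounds orc (Output E) = 0"
| "rounds orc (Round qs next) = Suc (rounds orc (next (map orc qs)))"

text \<open>Queries must be subsets of the known vertex set. Cost bounds are in terms of the hidden graph,
  via \<open>k = treewidth V E\<close> and \<open>n = card V\<close>. The maxima only affect \<open>k \<le> 1\<close>: there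
  \<open>k\<^sup>2 * ln n\<close> or \<open>ln k\<close> vanishes, although at least one query is unavoidable for \<open>n \<ge> 2\<close>.\<close>

definition within_budget ::
    "real \<Rightarrow> nat \<Rightarrow> 'a set \<Rightarrow> 'a set set \<Rightarrow> 'a strategy \<Rightarrow> bool" where
  "within_budget C d V E s \<longleftrightarrow>
     (\<forall>S \<in> set (queries (cc_oracle E) s). S \<subseteq> V) \<and>
     real (length (queries (cc_oracle E) s))
       \<le> C * real (max 1 (treewidth V E)) ^ d * ln (real (card V)) \<and>
     real (rounds (cc_oracle E) s) \<le> C * ln (real (max 2 (treewidth V E)))"

end

theory Submission
  imports Defs
begin

text \<open>
  Fix a guess \<open>K\<close> for the treewidth and call a pair of vertices split by a query if the answer
  separates them. The unsplit pairs \<open>H\<close> contain all edges. A random set with density of order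
  \<open>1/K\<close> avoids a given set of \<open>K + 1\<close> vertices and contains one of \<open>K\<close> given disjoint pairs with
  probability of order \<open>1/K\<close>, and there are only \<open>n\<^bsup>O(K)\<^esup>\<close> such configurations; so some fixed
  list of \<open>O(K\<^sup>2 log n)\<close> queries serves them all. After these queries \<open>H\<close> is
  \<open>5K\<close>-degenerate whenever the treewidth is at most \<open>K\<close>: in a set \<open>U\<close> where all \<open>H\<close>-degrees
  exceed \<open>5K\<close>, a bag \<open>X\<close> cuts off between \<open>K\<close> and \<open>3K\<close> vertices of \<open>U\<close>, each with at least
  \<open>K\<close> \<open>H\<close>-neighbours beyond \<open>X\<close>; among the resulting \<open>K\<close> disjoint pairs, one lies in a query
  that avoids \<open>X\<close>, and this query splits it.

  If \<open>H\<close> is \<open>D\<close>-degenerate, orient it with outdegrees at most \<open>D\<close>. A random set of density of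
  order \<open>1/D\<close>, restricted to its vertices with at most one out-neighbour inside, induces a
  forest in \<open>H\<close> and contains a given edge of \<open>H\<close> with probability of order \<open>1/D\<^sup>2\<close>. Hence
  \<open>O(D\<^sup>2 log n)\<close> such queries determine which pairs of \<open>H\<close> are edges. If \<open>H\<close> is not
  \<open>5K\<close>-degenerate, the treewidth exceeds \<open>K\<close>, and \<open>K\<close> is doubled. This deterministic strategy
  uses \<open>O(k\<^sup>2 log n)\<close> queries and so yields both parts.
\<close>

subsection \<open>Oracle answers and components\<close>

lemma sym_induced_adj: "sym (induced_adj E S)"
  by (auto simp: sym_def induced_adj_def insert_commute)

text \<open>Turns answers into reachability inside the query. Symmetry of adjacency is what joins
  \<open>u\<close> to \<open>v\<close> through the representative \<open>x\<close> of their
  class.\<close>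

lemma cc_oracle_joins_iff:
  "(\<exists>c \<in> cc_oracle E S. {u, v} \<subseteq> c) \<longleftrightarrow> u \<in> S \<and> v \<in> S \<and> (u, v) \<in> (induced_adj E S)\<^sup>*"
  (is "?L \<longleftrightarrow> ?R")
proof
  assume ?L
  then obtain x where x: "u \<in> S" "v \<in> S" "(x, u) \<in> (induced_adj E S)\<^sup>*" "(x, v) \<in> (induced_adj E S)\<^sup>*"
    by (auto simp: cc_oracle_def quotient_def)
  have "(u, x) \<in> (induced_adj E S)\<^sup>*"
    using x(3) sym_rtrancl[OF sym_induced_adj] by (metis symD)
  then show ?R using x by (meson rtrancl_trans)
next
  assume ?R
  then show ?L
    unfolding cc_oracle_def quotient_def by auto
qed

lemma rtrancl_closed:
  assumes "(u, v) \<in> r\<^sup>*" "u \<in> C" "\<And>x y. x \<in> C \<Longrightarrow> (x, y) \<in> r \<Longrightarrow> y \<in> C"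
  shows "v \<in> C"
  using assms(1,2) by (induction rule: rtrancl_induct) (auto intro: assms(3))

subsection \<open>Parts cut off by a bag\<close>

text \<open>The first vertex of a longest path is a leaf: a neighbour off the path would prolong it,
  and one beyond the second vertex would close a cycle.\<close>

lemma acyclic_connected_leaf:
  assumes fin: "finite I" and conn: "induces_connected F I" and acyc: "\<nexists>xs. is_cycle F xs"
    and loopfree: "\<And>i. {i} \<notin> F" and ab: "a \<in> I" "b \<in> I" "a \<noteq> b"
  obtains l t where "l \<in> I" "t \<in> I" "l \<noteq> t" "\<And>j. j \<in> I \<Longrightarrow> {l, j} \<in> F \<Longrightarrow> j = t"
proof -
  define Path where "Path xs \<longleftrightarrow> set xs \<subseteq> I \<and> distinct xs \<and>
      (\<forall>i. Suc i < length xs \<longrightarrow> {xs ! i, xs ! Suc i} \<in> F)" for xs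
  have bound: "length xs \<le> card I" if "Path xs" for xs
    using that card_mono[OF fin, of "set xs"] by (auto simp: Path_def distinct_card)
  have "(a, b) \<in> (induced_adj F I)\<^sup>*"
    using conn ab by (auto simp: induces_connected_def)
  then obtain c where c: "(a, c) \<in> induced_adj F I"
    using ab(3) by (metis converse_rtranclE)
  then have "Path [a, c]"
    using ab loopfree by (auto simp: Path_def induced_adj_def less_Suc_eq)
  then obtain xs where xs: "Path xs" and max: "\<And>ys. Path ys \<Longrightarrow> length ys \<le> length xs"
    using ex_has_greatest_nat[of Path "[a, c]" length "Suc (card I)"] bound
    by (metis le_imp_less_Suc)
  have len: "2 \<le> length xs"
    using max[OF \<open>Path [a, c]\<close>] by simp
  show thesis
  proof
    show "xs ! 0 \<in> I" "xs ! 1 \<in> I"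
      using xs len by (auto simp: Path_def intro!: subsetD[OF _ nth_mem])
    show "xs ! 0 \<noteq> xs ! 1"
    proof -
      have "distinct xs" using xs by (simp add: Path_def)
      then show ?thesis using len by (subst nth_eq_iff_index_eq) auto
    qed
    fix j assume j: "j \<in> I" "{xs ! 0, j} \<in> F"
    have "j \<in> set xs"
    proof (rule ccontr)
      assume "j \<notin> set xs"
      then have "Path (j # xs)"
        using xs j unfolding Path_def by (auto simp: nth_Cons insert_commute split: nat.splits)
      then show False using max by fastforce
    qed
    then obtain m where m: "m < length xs" "j = xs ! m"
      by (auto simp: in_set_conv_nth)
    have "\<not> 2 \<le> m"
    proof
      assume m2: "2 \<le> m"
      have "is_cycle F (take (Suc m) xs)"
        unfolding is_cycle_def
      proof (intro conjI allI impI)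
        show "3 \<le> length (take (Suc m) xs)" using m m2 by simp
        show "distinct (take (Suc m) xs)" using xs by (simp add: Path_def)
        fix i assume i: "i < length (take (Suc m) xs)"
        have l: "length (take (Suc m) xs) = Suc m" using m by simp
        show "{take (Suc m) xs ! i, take (Suc m) xs ! ((i + 1) mod length (take (Suc m) xs))} \<in> F"
        proof (cases "i = m")
          case True
          then show ?thesis using l m j by (simp add: insert_commute)
        next
          case False
          then have "i < m" using i l by simp
          then show ?thesis using l m xs by (simp add: Path_def)
        qed
      qed
      then show False using acyc by blast
    qed
    moreover have "m \<noteq> 0"
      using m(2) j(2) loopfree[of "xs ! 0"] by (intro notI) simp
    ultimately have "m = 1" by simp
    then show "j = xs ! 1" using m by simp
  qed
qed

text \<open>A walk that visits \<open>l\<close> enters and leaves it through \<open>t\<close>, so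
  the detour can be cut out.\<close>

lemma induces_connected_remove_leaf:
  assumes conn: "induces_connected F S" and leaf: "\<And>j. j \<in> S \<Longrightarrow> {l, j} \<in> F \<Longrightarrow> j = t"
  shows "induces_connected F (S - {l})"
proof -
  \<comment> \<open>While the walk sits at \<open>l\<close>, the second conjunct remembers that
    \<open>t\<close> was reached without \<open>l\<close>.\<close>
  have "(u \<noteq> l \<longrightarrow> v \<noteq> l \<longrightarrow> (u, v) \<in> (induced_adj F (S - {l}))\<^sup>*)
      \<and> (u \<noteq> l \<longrightarrow> v = l \<longrightarrow> t \<noteq> l \<longrightarrow> (u, t) \<in> (induced_adj F (S - {l}))\<^sup>*)"
    if "(u, v) \<in> (induced_adj F S)\<^sup>*" for u v
    using that
  proof (induction rule: rtrancl_induct)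
    case base
    then show ?case by auto
  next
    case (step y z)
    have yz: "y \<in> S" "z \<in> S" "{y, z} \<in> F" "{z, y} \<in> F"
      using step.hyps(2) by (auto simp: induced_adj_def insert_commute)
    consider "z = l" "y = l" | "z = l" "y \<noteq> l" | "z \<noteq> l" "y = l" | "z \<noteq> l" "y \<noteq> l" by blast
    then show ?case
    proof cases
      case 2
      then have "y = t" using leaf yz by blast
      then show ?thesis using 2 step.IH by auto
    next
      case 3
      then have "z = t" using leaf yz by blast
      then show ?thesis using 3 step.IH by auto
    next
      case 4
      then have "(y, z) \<in> induced_adj F (S - {l})" using yz by (auto simp: induced_adj_def)
      then show ?thesis using 4 step.IH by (auto intro: rtrancl_into_rtrancl)
    qed (use step.IH in auto)
  qed
  then show ?thesis
    using conn by (auto simp: induces_connected_def)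
qed

text \<open>\<open>P i\<close> holds the vertices that occurred only in leaves already removed and whose
  remaining neighbours lie in \<open>B i\<close>. Removing a leaf adds fewer than \<open>2K + 1\<close> vertices of \<open>U\<close> to the
  set of its neighbour, so the first such set with \<open>K\<close> of them has at most \<open>3K\<close>.\<close>

lemma bounded_part_of_decomposition:
  assumes "finite I" "I \<noteq> {}" "induces_connected F I" and acyc: "\<nexists>xs. is_cycle F xs"
    and loopfree: "\<And>i. {i} \<notin> F"
    and bags: "\<And>i. i \<in> I \<Longrightarrow> finite (B i) \<and> card (B i) \<le> K + 1"
    and "\<And>v. induces_connected F {i \<in> I. v \<in> B i}"
    and "\<And>i j. i \<in> I \<Longrightarrow> j \<in> I \<Longrightarrow> P i \<inter> B j = {}"
    and "\<And>i. i \<in> I \<Longrightarrow> card (P i \<inter> U) < K"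
    and "\<And>i a b. i \<in> I \<Longrightarrow> {a, b} \<in> E \<Longrightarrow> a \<in> P i \<Longrightarrow> b \<in> P i \<union> B i"
    and "\<And>a b. {a, b} \<in> E \<Longrightarrow> \<exists>i\<in>I. {a, b} \<subseteq> B i \<or> a \<in> P i \<or> b \<in> P i"
    and "U \<subseteq> (\<Union>i\<in>I. P i \<union> B i)"
    and U: "finite U" "2 * K + 1 \<le> card U"
  shows "\<exists>X A. finite X \<and> card X \<le> K + 1 \<and> X \<inter> A = {} \<and> K \<le> card (A \<inter> U) \<and>
    card (A \<inter> U) \<le> 3 * K \<and> (\<forall>a b. {a, b} \<in> E \<longrightarrow> a \<in> A \<longrightarrow> b \<in> A \<union> X)"
  using assms
proof (induction "card I" arbitrary: I P rule: less_induct)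
  case less
  note fin = less.prems(1) and ne = less.prems(2) and conn = less.prems(3) and bags = less.prems(6)
    and conn_v = less.prems(7) and disj = less.prems(8) and small = less.prems(9)
    and closed = less.prems(10) and cover = less.prems(11) and covU = less.prems(12)
  obtain i where i: "i \<in> I" using ne by blast
  show ?case
  proof (cases "I = {i}")
    case True
    \<comment> \<open>A single remaining bag is impossible: it would leave room for at most
      \<open>(K - 1) + (K + 1) = 2 * K\<close> vertices of \<open>U\<close>.\<close>
    have "card U \<le> card ((P i \<inter> U) \<union> B i)"
      using covU True U bags[OF i] by (intro card_mono) auto
    also have "\<dots> \<le> card (P i \<inter> U) + card (B i)" by (rule card_Un_le)
    finally show ?thesis using small[OF i] bags[OF i] U by simp
  next
    case False
    then obtain j where j: "j \<in> I" "j \<noteq> i" using i by blast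
    obtain l t where lt: "l \<in> I" "t \<in> I" "l \<noteq> t" and leaf: "\<And>j. j \<in> I \<Longrightarrow> {l, j} \<in> F \<Longrightarrow> j = t"
      using acyclic_connected_leaf[OF fin conn acyc loopfree j(1) i j(2)] by metis
    \<comment> \<open>The nodes whose bags contain \<open>a\<close> form a connected set, and
      \<open>l\<close> is joined to other nodes only through \<open>t\<close>.\<close>
    have local_vertex: "a \<notin> B i" if a: "a \<in> B l" "a \<notin> B t" and i: "i \<in> I" "i \<noteq> l" for a i
    proof
      assume "a \<in> B i"
      then have "(l, i) \<in> (induced_adj F {i \<in> I. a \<in> B i})\<^sup>*"
        using conn_v[of a] a i lt by (auto simp: induces_connected_def)
      then obtain c where "(l, c) \<in> induced_adj F {i \<in> I. a \<in> B i}"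
        using i(2) by (metis converse_rtranclE)
      then have "c \<in> I" "{l, c} \<in> F" "a \<in> B c" by (auto simp: induced_adj_def)
      then show False using leaf[of c] a by blast
    qed
    define A where "A = P t \<union> P l \<union> (B l - B t)"
    define P' where "P' = P(t := A)"
    have A_disj: "A \<inter> B i = {}" if "i \<in> I - {l}" for i
      using that disj[OF lt(2), of i] disj[OF lt(1), of i] local_vertex[of _ i] by (auto simp: A_def)
    have A_closed: "b \<in> A \<union> B t" if e: "{a, b} \<in> E" and a: "a \<in> A" for a b
    proof -
      consider "a \<in> P t" | "a \<in> P l" | "a \<in> B l" "a \<notin> B t" using a by (auto simp: A_def)
      then show ?thesis
      proof cases
        case 1
        then show ?thesis using closed[OF lt(2) e] by (auto simp: A_def)
      next
        case 2
        then show ?thesis using closed[OF lt(1) e] by (auto simp: A_def)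
      next
        case 3
        obtain i where i: "i \<in> I" "{a, b} \<subseteq> B i \<or> a \<in> P i \<or> b \<in> P i" using cover[OF e] by blast
        have aP: "a \<notin> P i" using disj[OF i(1) lt(1)] 3 by blast
        have "a \<in> B i"
          using i aP closed[OF i(1), of b a] e by (auto simp: insert_commute)
        then have "i = l" using local_vertex 3 i by blast
        then show ?thesis using i aP by (auto simp: A_def)
      qed
    qed
    \<comment> \<open>The three parts contribute at most \<open>K - 1\<close>, \<open>K - 1\<close>
      and \<open>K + 1\<close>.\<close>
    have "card (A \<inter> U) \<le> card (((P t \<inter> U) \<union> (P l \<inter> U)) \<union> B l)"
      using U bags[OF lt(1)] by (intro card_mono) (auto simp: A_def)
    also have "\<dots> \<le> card (P t \<inter> U) + card (P l \<inter> U) + card (B l)"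
      by (meson card_Un_le le_trans add_le_mono1)
    finally have A_le: "card (A \<inter> U) \<le> 3 * K"
      using small[OF lt(1)] small[OF lt(2)] bags[OF lt(1)] by simp
    show ?thesis
    proof (cases "K \<le> card (A \<inter> U)")
      case True
      then show ?thesis
        using A_le A_closed A_disj[of t] bags[OF lt(2)] lt by (intro exI[of _ "B t"] exI[of _ A]) auto
    next
      case A_small: False
      show ?thesis
      proof (rule less.hyps[of "I - {l}" P'])
        show "card (I - {l}) < card I" by (rule card_Diff1_less[OF fin lt(1)])
        show "I - {l} \<noteq> {}" using lt by blast
        show "induces_connected F (I - {l})"
          using conn leaf by (rule induces_connected_remove_leaf)
        fix v
        have "induces_connected F ({i \<in> I. v \<in> B i} - {l})"
          using conn_v leaf by (intro induces_connected_remove_leaf[of F _ l t]) auto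
        moreover have "{i \<in> I. v \<in> B i} - {l} = {i \<in> I - {l}. v \<in> B i}" by blast
        ultimately show "induces_connected F {i \<in> I - {l}. v \<in> B i}" by simp
      next
        fix a b assume e: "{a, b} \<in> E"
        obtain i where i: "i \<in> I" "{a, b} \<subseteq> B i \<or> a \<in> P i \<or> b \<in> P i" using cover[OF e] by blast
        show "\<exists>i\<in>I - {l}. {a, b} \<subseteq> B i \<or> a \<in> P' i \<or> b \<in> P' i"
        proof (cases "i = l \<or> i = t")
          case True
          then show ?thesis using i lt by (intro bexI[of _ t]) (auto simp: P'_def A_def)
        next
          case False
          then show ?thesis using i by (intro bexI[of _ i]) (auto simp: P'_def)
        qed
      next
        show "U \<subseteq> (\<Union>i\<in>I - {l}. P' i \<union> B i)"
        proof
          fix x assume "x \<in> U"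
          then obtain i where i: "i \<in> I" "x \<in> P i \<union> B i" using covU by blast
          show "x \<in> (\<Union>i\<in>I - {l}. P' i \<union> B i)"
          proof (cases "i = l \<or> i = t")
            case True
            then show ?thesis using i lt by (intro UN_I[of t]) (auto simp: P'_def A_def)
          next
            case False
            then show ?thesis using i by (intro UN_I[of i]) (auto simp: P'_def)
          qed
        qed
      qed (use fin acyc loopfree bags disj small closed A_disj A_closed A_small U in
            \<open>auto simp: P'_def split: if_splits\<close>)
    qed
  qed
qed

lemma treewidth_attained:
  assumes "simple_graph V E"
  obtains I F B where "tree_decomposition V E I F B" "width I B = treewidth V E"
proof -
  have "\<exists>w I F B. tree_decomposition V E I F B \<and> width I B = w"
    using tree_decomposition_trivial[OF assms] by blast
  from LeastI_ex[OF this] show thesis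
    using that unfolding treewidth_def by blast
qed

lemma treewidth_le_card:
  assumes "simple_graph V E"
  shows "treewidth V E \<le> card V"
proof -
  have "treewidth V E \<le> width {0} (\<lambda>_. V)"
    unfolding treewidth_def using tree_decomposition_trivial[OF assms] by (intro Least_le) blast
  then show ?thesis by (simp add: width_def)
qed

text \<open>Leaf removal is started on an optimal decomposition with every \<open>P i\<close> empty;
  \<open>0 < K\<close> makes these sets small enough.\<close>

lemma small_treewidth_part:
  assumes G: "simple_graph V E" and tw: "treewidth V E \<le> K" and K: "0 < K"
    and U: "U \<subseteq> V" "2 * K + 1 \<le> card U"
  shows "\<exists>X A. finite X \<and> card X \<le> K + 1 \<and> X \<inter> A = {} \<and> K \<le> card (A \<inter> U) \<and>
    card (A \<inter> U) \<le> 3 * K \<and> (\<forall>a b. {a, b} \<in> E \<longrightarrow> a \<in> A \<longrightarrow> b \<in> A \<union> X)"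
proof -
  obtain I F B where td: "tree_decomposition V E I F B" and w: "width I B = treewidth V E"
    using treewidth_attained[OF G] .
  have I: "finite I" "I \<noteq> {}" "induces_connected F I" "\<nexists>xs. is_cycle F xs" "simple_graph I F"
    using td by (auto simp: tree_decomposition_def is_tree_def simple_graph_def)
  have V: "finite V" using G by (simp add: simple_graph_def)
  have BV: "(\<Union>i\<in>I. B i) = V" using td by (simp add: tree_decomposition_def)
  show ?thesis
  proof (rule bounded_part_of_decomposition[where P = "\<lambda>_. {}" and F = F])
    show "{i} \<notin> F" for i using I(5) by (auto simp: simple_graph_def doubleton_eq_iff)
    show "finite (B i) \<and> card (B i) \<le> K + 1" if "i \<in> I" for i
    proof
      show "finite (B i)" using BV that by (intro finite_subset[OF _ V]) blast
      \<comment> \<open>The truncated subtraction in \<open>width\<close> is harmless: the largest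
        bag has at most \<open>width I B + 1\<close> vertices in every case.\<close>
      have "card (B i) \<le> Max ((\<lambda>i. card (B i)) ` I)" using I that by (intro Max_ge) auto
      then show "card (B i) \<le> K + 1" using w tw by (simp add: width_def)
    qed
    show "induces_connected F {i \<in> I. v \<in> B i}" for v
    proof (cases "v \<in> V")
      case True
      then show ?thesis using td by (simp add: tree_decomposition_def)
    next
      case False
      then have "{i \<in> I. v \<in> B i} = {}" using BV by blast
      then show ?thesis by (simp only:) (simp add: induces_connected_def)
    qed
    show "\<exists>i\<in>I. {a, b} \<subseteq> B i \<or> a \<in> {} \<or> b \<in> {}" if "{a, b} \<in> E" for a b
    proof -
      have "\<forall>e\<in>E. \<exists>i\<in>I. e \<subseteq> B i" using td by (simp add: tree_decomposition_def)
      then show ?thesis using that by blast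
    qed
    show "finite U" by (rule finite_subset[OF U(1) V])
  qed (use I K U BV in auto)
qed

subsection \<open>Degeneracy of the unsplit pairs\<close>

text \<open>The elements are served one after another; those served earlier occupy fewer than
  \<open>card A\<close> candidates, so a fresh one remains.\<close>

lemma greedy_injective_choice:
  assumes "finite A" "\<And>a. a \<in> A \<Longrightarrow> finite (N a) \<and> card A \<le> card (N a)"
  shows "\<exists>f. inj_on f A \<and> (\<forall>a\<in>A. f a \<in> N a)"
  using assms
proof (induction rule: finite_induct)
  case (insert x A)
  obtain f where f: "inj_on f A" "\<forall>a\<in>A. f a \<in> N a"
    using insert by fastforce
  have "card (f ` A) < card (N x)"
    using insert.prems[of x] insert.hyps by (simp add: card_image f)
  then obtain y where y: "y \<in> N x" "y \<notin> f ` A"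
    using insert.hyps by (metis card_mono finite_imageI leD subsetI)
  have "inj_on (f(x := y)) (insert x A)"
    using f y insert.hyps by (auto simp: inj_on_def)
  moreover have "\<forall>a\<in>insert x A. (f(x := y)) a \<in> N a"
    using f y by auto
  ultimately show ?case by blast
qed auto

text \<open>The answers come as a function \<open>orc\<close>, so that the same filter can be stated
  for the true oracle and computed from recorded answers.\<close>

definition unsplit :: "('a set \<Rightarrow> 'a set set) \<Rightarrow> 'a set list \<Rightarrow> 'a set set \<Rightarrow> 'a set set" where
  "unsplit orc qs H = {e \<in> H. \<forall>S \<in> set qs. e \<subseteq> S \<longrightarrow> (\<exists>c \<in> orc S. e \<subseteq> c)}"

definition pairs :: "'a set \<Rightarrow> 'a set set" where
  "pairs V = {{u, v} |u v. u \<in> V \<and> v \<in> V \<and> u \<noteq> v}"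

text \<open>An edge inside a query keeps its ends in one component, so filtering never loses an
  edge.\<close>

lemma subset_unsplit:
  assumes "E \<subseteq> H" "E \<subseteq> pairs V"
  shows "E \<subseteq> unsplit (cc_oracle E) qs H"
proof
  fix e assume e: "e \<in> E"
  then obtain u v where uv: "e = {u, v}" using assms by (auto simp: pairs_def)
  have "\<exists>c\<in>cc_oracle E S. e \<subseteq> c" if "e \<subseteq> S" for S
    unfolding uv cc_oracle_joins_iff using that e uv by (auto simp: induced_adj_def)
  then show "e \<in> unsplit (cc_oracle E) qs H"
    using e assms by (auto simp: unsplit_def)
qed

definition degenerate :: "nat \<Rightarrow> 'a set \<Rightarrow> 'a set set \<Rightarrow> bool" where
  "degenerate D V H \<longleftrightarrow> (\<forall>U\<subseteq>V. U \<noteq> {} \<longrightarrow> (\<exists>u\<in>U. card {v \<in> U. {u, v} \<in> H} \<le> D))"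

text \<open>The list \<open>zs\<close> enumerates the left ends of a matching of size \<open>K\<close>, then the corresponding right
  ends, then a separator; the separator part may repeat vertices as padding.\<close>

definition isolates_matchings :: "nat \<Rightarrow> 'a set \<Rightarrow> 'a set list \<Rightarrow> bool" where
  "isolates_matchings K V qs \<longleftrightarrow>
     (\<forall>zs. set zs \<subseteq> V \<and> length zs = 3 * K + 1 \<and> distinct (take (2 * K) zs) \<longrightarrow>
        (\<exists>S \<in> set qs. \<exists>i<K. S \<inter> set zs = {zs ! i, zs ! (K + i)}))"

lemma degenerate_unsplit:
  assumes G: "simple_graph V E" and tw: "treewidth V E \<le> K" and K: "0 < K"
    and qs: "isolates_matchings K V qs"
  shows "degenerate (5 * K) V (unsplit (cc_oracle E) qs (pairs V))"
  unfolding degenerate_def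
proof (intro allI impI)
  fix U assume U: "U \<subseteq> V" "U \<noteq> {}"
  define H where "H = unsplit (cc_oracle E) qs (pairs V)"
  have V: "finite V" using G by (simp add: simple_graph_def)
  then have finU: "finite U" by (rule finite_subset[OF U(1)])
  have "\<exists>u\<in>U. card {v \<in> U. {u, v} \<in> H} \<le> 5 * K"
  proof (rule ccontr)
    assume "\<not> ?thesis"
    then have deg: "5 * K < card {v \<in> U. {u, v} \<in> H}" if "u \<in> U" for u
      using that by force
    obtain u where "u \<in> U" using U by blast
    have "card {v \<in> U. {u, v} \<in> H} \<le> card U" using finU by (intro card_mono) auto
    then have "2 * K + 1 \<le> card U" using deg[OF \<open>u \<in> U\<close>] by simp
    then obtain X A where X: "finite X" "card X \<le> K + 1" "X \<inter> A = {}"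
      and A: "K \<le> card (A \<inter> U)" "card (A \<inter> U) \<le> 3 * K"
      and closed: "\<And>a b. {a, b} \<in> E \<Longrightarrow> a \<in> A \<Longrightarrow> b \<in> A \<union> X"
      using small_treewidth_part[OF G tw K U(1)] by blast
    obtain A0 where A0: "A0 \<subseteq> A \<inter> U" "card A0 = K" "finite A0"
      using A(1) obtain_subset_with_card_n[of K "A \<inter> U"] by blast
    define N where "N a = {v \<in> U. {a, v} \<in> H} - (A \<inter> U) - X" for a
    have "\<exists>f. inj_on f A0 \<and> (\<forall>a\<in>A0. f a \<in> N a)"
    proof (rule greedy_injective_choice)
      fix a assume "a \<in> A0"
      then have "5 * K < card {v \<in> U. {a, v} \<in> H}" using deg A0 by blast
      \<comment> \<open>This is where \<open>5 * K\<close> comes from: more than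
        \<open>5 * K\<close> neighbours, less at most \<open>3 * K\<close> in \<open>A\<close> and
        \<open>K + 1\<close> in \<open>X\<close>, leave \<open>K\<close> for the greedy
        choice.\<close>
      moreover have "card {v \<in> U. {a, v} \<in> H} - card (A \<inter> U) - card X \<le> card (N a)"
        unfolding N_def using X(1) finU
        by (metis (no_types, lifting) diff_card_le_card_Diff diff_le_mono finite_Int le_trans)
      ultimately show "finite (N a) \<and> card A0 \<le> card (N a)"
        using A X A0 finU by (auto simp: N_def)
    qed (use A0 in auto)
    then obtain f where f: "inj_on f A0" "\<And>a. a \<in> A0 \<Longrightarrow> f a \<in> N a" by blast
    obtain as where as: "set as = A0" "distinct as" "length as = K"
      using finite_distinct_list[OF A0(3)] A0(2) distinct_card by metis
    obtain xs where xs: "set xs = X \<inter> V" "distinct xs"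
      using finite_distinct_list[of "X \<inter> V"] X(1) by blast
    have xs_len: "length xs \<le> K + 1"
      using distinct_card[OF xs(2)] xs(1) X card_mono[of X "X \<inter> V"] by auto
    \<comment> \<open>Padding with \<open>as ! 0\<close> brings the list to its prescribed length
      without adding a vertex to its set.\<close>
    define zs where "zs = as @ map f as @ xs @ replicate (K + 1 - length xs) (as ! 0)"
    have as0: "as ! 0 \<in> A0" using as K by (metis nth_mem)
    have zs_set: "set zs = A0 \<union> f ` A0 \<union> (X \<inter> V)"
      using as xs as0 by (auto simp: zs_def)
    have fN: "f a \<in> U" "f a \<notin> A" "f a \<notin> X" "{a, f a} \<in> H" if "a \<in> A0" for a
      using f(2)[OF that] by (auto simp: N_def)
    have "set zs \<subseteq> V" using zs_set A0 fN U by blast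
    moreover have "length zs = 3 * K + 1" using as xs_len by (simp add: zs_def)
    moreover have "distinct (take (2 * K) zs)"
      using as f(1) fN A0 by (auto simp: zs_def distinct_map)
    ultimately obtain S i where S: "S \<in> set qs" "i < K" "S \<inter> set zs = {zs ! i, zs ! (K + i)}"
      using qs unfolding isolates_matchings_def by blast
    define a where "a = as ! i"
    have a: "a \<in> A0" using as S by (auto simp: a_def)
    have S': "S \<inter> (A0 \<union> f ` A0 \<union> (X \<inter> V)) = {a, f a}"
      using S as by (simp add: zs_set[symmetric]) (simp add: zs_def nth_append a_def)
    have aA: "a \<in> A" using a A0 by blast
    have "X \<inter> V \<inter> S = {}"
    proof (rule equals0I)
      fix x assume x: "x \<in> X \<inter> V \<inter> S"
      then have "x \<in> {a, f a}" unfolding S'[symmetric] by blast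
      then show False using x X(3) aA fN(3)[OF a] by blast
    qed
    moreover have "y \<in> V" if "{x, y} \<in> E" for x y
      using that G unfolding simple_graph_def by (auto simp: doubleton_eq_iff dest!: subsetD)
    ultimately have SX: "y \<notin> X" if "y \<in> S" "{x, y} \<in> E" for x y
      using that by blast
    have "{a, f a} \<subseteq> S" using S' by blast
    then have "\<exists>c\<in>cc_oracle E S. {a, f a} \<subseteq> c"
      using fN(4)[OF a] S(1) unfolding H_def unsplit_def by blast
    then have "(a, f a) \<in> (induced_adj E S)\<^sup>*" unfolding cc_oracle_joins_iff by blast
    \<comment> \<open>Edges of \<open>E\<close> leave \<open>A\<close> only into \<open>X\<close>,
      which \<open>S\<close> avoids, so a walk inside \<open>S\<close> that starts in
      \<open>A\<close> stays there, although \<open>f a\<close> lies outside.\<close>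
    then have "f a \<in> A"
      using aA by (rule rtrancl_closed) (use closed SX in \<open>auto simp: induced_adj_def\<close>)
    then show False using fN[OF a] by blast
  qed
  then show "\<exists>u\<in>U. card {v \<in> U. {u, v} \<in> unsplit (cc_oracle E) qs (pairs V)} \<le> 5 * K"
    by (simp add: H_def)
qed

subsection \<open>Short query lists from random sets\<close>

text \<open>By averaging, some member of \<open>\<Omega>\<close> satisfies at least a fraction
  \<open>q\<close> of the requirements still open; choosing it greedily shrinks their number by a
  factor \<open>1 - q\<close> per query.\<close>

lemma weighted_cover:
  fixes w :: "'s \<Rightarrow> real" and sat :: "'r \<Rightarrow> 's \<Rightarrow> bool"
  assumes \<Omega>: "finite \<Omega>" "\<And>S. S \<in> \<Omega> \<Longrightarrow> 0 \<le> w S" "sum w \<Omega> = 1"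
    and R: "finite R" "\<And>r. r \<in> R \<Longrightarrow> q \<le> sum w {S \<in> \<Omega>. sat r S}" and q: "q \<le> 1"
  shows "\<exists>qs. length qs = m \<and> set qs \<subseteq> \<Omega> \<and>
    real (card {r \<in> R. \<forall>S \<in> set qs. \<not> sat r S}) \<le> (1 - q) ^ m * real (card R)"
proof (induction m)
  case 0
  then show ?case by simp
next
  case (Suc m)
  then obtain qs where qs: "length qs = m" "set qs \<subseteq> \<Omega>"
    "real (card {r \<in> R. \<forall>S \<in> set qs. \<not> sat r S}) \<le> (1 - q) ^ m * real (card R)" by blast
  define R' where "R' = {r \<in> R. \<forall>S \<in> set qs. \<not> sat r S}"
  have finR': "finite R'" using R by (simp add: R'_def)
  define g where "g S = real (card {r \<in> R'. sat r S})" for S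
  have "\<Omega> \<noteq> {}" using \<Omega> by auto
  then have "Max (g ` \<Omega>) \<in> g ` \<Omega>" using \<Omega>(1) by (intro Max_in) auto
  then obtain T where T: "T \<in> \<Omega>" "g T = Max (g ` \<Omega>)" by force
  have g_max: "g S \<le> g T" if "S \<in> \<Omega>" for S
    unfolding T(2) using \<Omega>(1) that by (intro Max_ge) auto
  have g_sum: "g S = (\<Sum>r\<in>R'. if sat r S then 1 else 0)" for S
    using finR' by (simp add: g_def sum.If_cases Int_def)
  have "q * real (card R') = (\<Sum>r\<in>R'. q)" by simp
  also have "\<dots> \<le> (\<Sum>r\<in>R'. sum w {S \<in> \<Omega>. sat r S})"
    using R by (intro sum_mono) (auto simp: R'_def)
  also have "\<dots> = (\<Sum>r\<in>R'. \<Sum>S\<in>\<Omega>. if sat r S then w S else 0)"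
    using \<Omega>(1) by (simp add: sum.inter_filter)
  also have "\<dots> = (\<Sum>S\<in>\<Omega>. \<Sum>r\<in>R'. if sat r S then w S else 0)" by (rule sum.swap)
  also have "\<dots> = (\<Sum>S\<in>\<Omega>. w S * g S)"
    by (simp add: g_sum sum_distrib_left if_distrib cong: if_cong)
  also have "\<dots> \<le> (\<Sum>S\<in>\<Omega>. w S * g T)"
    using g_max \<Omega>(2) by (intro sum_mono mult_left_mono) auto
  also have "\<dots> = g T" using \<Omega>(3) by (simp add: sum_distrib_right[symmetric])
  finally have gT: "q * real (card R') \<le> g T" .
  have "{r \<in> R. \<forall>S \<in> set (T # qs). \<not> sat r S} = R' - {r \<in> R'. sat r T}"
    by (auto simp: R'_def)
  then have "real (card {r \<in> R. \<forall>S \<in> set (T # qs). \<not> sat r S}) = real (card R') - g T"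
    using finR' by (simp add: g_def card_Diff_subset of_nat_diff card_mono)
  also have "\<dots> \<le> (1 - q) * real (card R')" using gT by (simp add: algebra_simps)
  also have "\<dots> \<le> (1 - q) * ((1 - q) ^ m * real (card R))"
    using qs(3) q unfolding R'_def by (intro mult_left_mono) auto
  finally show ?case
    using qs T by (intro exI[of _ "T # qs"]) (simp add: mult.assoc)
qed

text \<open>Since \<open>1 - q \<le> exp (- q)\<close>, slightly more than \<open>ln N / q\<close>
  greedy choices leave fewer than one requirement open.\<close>

lemma short_weighted_cover:
  fixes w :: "'s \<Rightarrow> real" and sat :: "'r \<Rightarrow> 's \<Rightarrow> bool"
  assumes \<Omega>: "finite \<Omega>" "\<And>S. S \<in> \<Omega> \<Longrightarrow> 0 \<le> w S" "sum w \<Omega> = 1"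
    and R: "finite R" "\<And>r. r \<in> R \<Longrightarrow> q \<le> sum w {S \<in> \<Omega>. sat r S}" and q: "0 < q" "q \<le> 1"
    and N: "real (card R) \<le> N" "1 \<le> N"
  shows "\<exists>qs. real (length qs) \<le> ln N / q + 2 \<and> set qs \<subseteq> \<Omega> \<and> (\<forall>r\<in>R. \<exists>S \<in> set qs. sat r S)"
proof -
  \<comment> \<open>The added 1 makes \<open>ln N < q * m\<close> strict, which pushes the number of
    open requirements below one.\<close>
  define m where "m = nat \<lceil>ln N / q\<rceil> + 1"
  have nonneg: "0 \<le> ln N / q" using N q by simp
  have m: "ln N / q < real m" "real m \<le> ln N / q + 2" unfolding m_def using nonneg by linarith+
  have "\<exists>qs. length qs = m \<and> set qs \<subseteq> \<Omega> \<and>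
      real (card {r \<in> R. \<forall>S \<in> set qs. \<not> sat r S}) \<le> (1 - q) ^ m * real (card R)"
    by (rule weighted_cover[where w = w]) (use \<Omega> R q in auto)
  then obtain qs where qs: "length qs = m" "set qs \<subseteq> \<Omega>"
    "real (card {r \<in> R. \<forall>S \<in> set qs. \<not> sat r S}) \<le> (1 - q) ^ m * real (card R)" by blast
  have "(1 - q) ^ m \<le> exp (- q) ^ m"
    using q exp_ge_add_one_self[of "- q"] by (intro power_mono) auto
  also have "\<dots> = exp (- (q * m))" by (simp add: exp_of_nat_mult[symmetric] mult.commute)
  finally have le: "(1 - q) ^ m \<le> exp (- (q * m))" .
  have "ln N < q * m" using m(1) q by (simp add: field_simps)
  then have "exp (- (q * m)) < exp (- ln N)" by simp
  also have "\<dots> = 1 / N" using N by (simp add: exp_minus field_simps)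
  finally have "exp (- (q * m)) * N < 1" using N by (simp add: field_simps)
  moreover have "(1 - q) ^ m * real (card R) \<le> exp (- (q * m)) * N"
    using le N q by (intro mult_mono) auto
  ultimately have "card {r \<in> R. \<forall>S \<in> set qs. \<not> sat r S} < 1" using qs(3) by linarith
  then have "{r \<in> R. \<forall>S \<in> set qs. \<not> sat r S} = {}" using R(1) by simp
  then show ?thesis using qs m by (intro exI[of _ qs]) auto
qed

section \<open>Traces of binomial random sets\<close>

definition binomial_weight :: "real \<Rightarrow> 'a set \<Rightarrow> 'a set \<Rightarrow> real" where
  "binomial_weight p V S = p ^ card S * (1 - p) ^ card (V - S)"

text \<open>The weight is a product over vertices. With the factors of forbidden memberships set to
  zero, expanding the product of \<open>f x + g x\<close> over subsets keeps exactly the sets with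
  trace \<open>T\<close>.\<close>

lemma sum_binomial_weight_trace:
  assumes V: "finite V" and T: "T \<subseteq> W" and W: "W \<subseteq> V"
  shows "sum (binomial_weight p V) {S \<in> Pow V. S \<inter> W = T} = p ^ card T * (1 - p) ^ card (W - T)"
proof -
  define f where "f x = (if x \<in> W - T then 0 else p)" for x
  define g where "g x = (if x \<in> T then 0 else 1 - p)" for x
  have factor: "(\<Prod>x\<in>S. f x) * (\<Prod>x\<in>V - S. g x) = (if S \<inter> W = T then binomial_weight p V S else 0)"
    if S: "S \<subseteq> V" for S
  proof (cases "S \<inter> W = T")
    case True
    then have "(\<Prod>x\<in>S. f x) = (\<Prod>x\<in>S. p)" "(\<Prod>x\<in>V - S. g x) = (\<Prod>x\<in>V - S. 1 - p)"
      by (auto simp: f_def g_def intro!: prod.cong)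
    then show ?thesis using True by (simp add: binomial_weight_def)
  next
    case False
    then have "(\<exists>x\<in>S. x \<in> W - T) \<or> (\<exists>x\<in>V - S. x \<in> T)" using T W by blast
    then have "(\<exists>x\<in>S. f x = 0) \<or> (\<exists>x\<in>V - S. g x = 0)" unfolding f_def g_def by fastforce
    then have "(\<Prod>x\<in>S. f x) * (\<Prod>x\<in>V - S. g x) = 0"
      using V finite_subset[OF S V] prod_zero[of S f] prod_zero[of "V - S" g] by auto
    then show ?thesis using False by simp
  qed
  have indicator_prod: "(\<Prod>x\<in>V. if x \<in> Z then c else 1) = c ^ card Z"
    if "Z \<subseteq> V" for Z and c :: real
    using that V by (simp add: prod.If_cases Int_absorb1)
  have "sum (binomial_weight p V) {S \<in> Pow V. S \<inter> W = T}
      = (\<Sum>S\<in>Pow V. (\<Prod>x\<in>S. f x) * (\<Prod>x\<in>V - S. g x))"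
    using V by (subst sum.inter_filter) (auto simp: factor intro!: sum.cong)
  also have "\<dots> = (\<Prod>x\<in>V. f x + g x)" using V by (simp add: prod_add)
  also have "\<dots> = (\<Prod>x\<in>V. (if x \<in> T then p else 1) * (if x \<in> W - T then 1 - p else 1))"
    using T by (intro prod.cong) (auto simp: f_def g_def)
  also have "\<dots> = p ^ card T * (1 - p) ^ card (W - T)"
    unfolding prod.distrib using indicator_prod[of T p] indicator_prod[of "W - T" "1 - p"] T W by auto
  finally show ?thesis .
qed

lemma binomial_weight_total:
  assumes "finite V"
  shows "sum (binomial_weight p V) (Pow V) = 1"
  using sum_binomial_weight_trace[OF assms, of "{}" "{}" p] by (simp add: Pow_def)

lemma binomial_weight_nonneg: "0 \<le> p \<Longrightarrow> p \<le> 1 \<Longrightarrow> 0 \<le> binomial_weight p V S"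
  by (simp add: binomial_weight_def)

text \<open>For positive \<open>N\<close> the reciprocal of the power is
  \<open>(1 + 1 / N) ^ N\<close>, which is at most \<open>exp 1 < 3\<close>.\<close>

lemma power_one_minus_inverse_ge:
  "1 / 3 \<le> (1 - 1 / (real N + 1)) ^ N"
proof (cases "N = 0")
  case False
  have "(1 + 1 / real N) ^ N \<le> exp (1 / real N) ^ N"
    by (intro power_mono) (auto simp: exp_ge_add_one_self)
  also have "\<dots> = exp 1" using False by (simp add: exp_of_nat_mult[symmetric])
  also have "\<dots> \<le> 3" using e_less_272 by simp
  finally have "(1 + 1 / real N) ^ N \<le> 3" .
  moreover have "(1 + 1 / real N) ^ N * (1 - 1 / (real N + 1)) ^ N = 1"
  proof -
    have "(1 + 1 / real N) = (real N + 1) / real N" using False by (simp add: field_simps)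
    moreover have "1 - 1 / (real N + 1) = real N / (real N + 1)" by (simp add: field_simps)
    ultimately show ?thesis using False by (simp add: power_mult_distrib[symmetric])
  qed
  moreover have "0 \<le> (1 - 1 / (real N + 1)) ^ N" by (simp add: field_simps)
  ultimately have "1 \<le> 3 * (1 - 1 / (real N + 1)) ^ N"
    by (metis mult_right_mono)
  then show ?thesis by simp
qed simp

text \<open>Density \<open>1 / (N + 1)\<close> balances two demands: hitting the pair costs
  \<open>1 / (N + 1)\<^sup>2\<close>, and avoiding the at most \<open>N\<close> other vertices of
  \<open>W\<close> costs only a constant factor.\<close>

lemma sum_binomial_weight_pair_ge:
  assumes V: "finite V" and W: "W \<subseteq> V" "card W \<le> N + 2" and uv: "u \<in> W" "v \<in> W" "u \<noteq> v"
  shows "1 / (3 * (real N + 1)\<^sup>2) \<le>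
    sum (binomial_weight (1 / (real N + 1)) V) {S \<in> Pow V. S \<inter> W = {u, v}}"
proof -
  define p where "p = 1 / (real N + 1)"
  have p: "0 \<le> p" "p \<le> 1" by (auto simp: p_def)
  have "card (W - {u, v}) \<le> N" using W uv finite_subset[OF W(1) V] by (simp add: card_Diff_subset)
  then have "(1 - p) ^ N \<le> (1 - p) ^ card (W - {u, v})" using p by (intro power_decreasing) auto
  then have "1 / 3 \<le> (1 - p) ^ card (W - {u, v})"
    using power_one_minus_inverse_ge[of N] by (simp add: p_def)
  then have "p\<^sup>2 * (1 / 3) \<le> p\<^sup>2 * (1 - p) ^ card (W - {u, v})" by (intro mult_left_mono) auto
  moreover have "p\<^sup>2 * (1 / 3) = 1 / (3 * (real N + 1)\<^sup>2)" by (simp add: p_def power_divide)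
  moreover have "sum (binomial_weight p V) {S \<in> Pow V. S \<inter> W = {u, v}} =
      p ^ card {u, v} * (1 - p) ^ card (W - {u, v})"
    using uv by (intro sum_binomial_weight_trace V W) auto
  moreover have "card {u, v} = 2" using uv by simp
  ultimately show ?thesis by (simp only: p_def)
qed

lemma ln_nat_ge: "2 \<le> n \<Longrightarrow> 2 / 3 \<le> ln (real n)"
  using ln2_ge_two_thirds ln_le_cancel_iff[of 2 "real n"] by linarith

text \<open>For a fixed list, the \<open>K\<close> pairs give disjoint events of probability of
  order \<open>1 / K\<^sup>2\<close> each, hence \<open>q\<close> of order \<open>1 / K\<close>. The
  logarithm of the number of lists, at most \<open>card V ^ (3 * K + 1)\<close>, supplies the second
  factor \<open>K\<close>.\<close>

lemma isolates_matchings_exists: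
  assumes V: "finite V" "2 \<le> card V" and K: "0 < K"
  shows "\<exists>qs. isolates_matchings K V qs \<and> set qs \<subseteq> Pow V \<and>
    real (length qs) \<le> 195 * (real K)\<^sup>2 * ln (real (card V))"
proof -
  define p where "p = 1 / (real (3 * K) + 1)"
  define q where "q = 1 / (48 * real K)"
  define R where "R = {zs. set zs \<subseteq> V \<and> length zs = 3 * K + 1 \<and> distinct (take (2 * K) zs)}"
  define N where "N = real (card V) ^ (3 * K + 1)"
  have p: "0 \<le> p" "p \<le> 1" by (auto simp: p_def)
  have fin: "finite {zs. set zs \<subseteq> V \<and> length zs = 3 * K + 1}"
    using V(1) by (rule finite_lists_length_eq)
  have R: "finite R" "real (card R) \<le> N"
  proof -
    have sub: "R \<subseteq> {zs. set zs \<subseteq> V \<and> length zs = 3 * K + 1}" by (auto simp: R_def)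
    show "finite R" using sub fin by (rule finite_subset)
    have "card R \<le> card V ^ (3 * K + 1)"
      using card_mono[OF fin sub] V by (simp add: card_lists_length_eq)
    then show "real (card R) \<le> N" unfolding N_def by (metis of_nat_le_iff of_nat_power)
  qed
  have hit: "q \<le> sum (binomial_weight p V)
      {S \<in> Pow V. \<exists>i<K. S \<inter> set zs = {zs ! i, zs ! (K + i)}}" if "zs \<in> R" for zs
  proof -
    have zs: "set zs \<subseteq> V" "length zs = 3 * K + 1" "distinct (take (2 * K) zs)"
      using that by (auto simp: R_def)
    have ne: "zs ! i \<noteq> zs ! j" if "i < 2 * K" "j < 2 * K" "i \<noteq> j" for i j
      using zs that nth_eq_iff_index_eq[OF zs(3), of i j] by simp
    define P where "P i = {S \<in> Pow V. S \<inter> set zs = {zs ! i, zs ! (K + i)}}" for i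
    have "{S \<in> Pow V. \<exists>i<K. S \<inter> set zs = {zs ! i, zs ! (K + i)}} = (\<Union>i<K. P i)"
      by (auto simp: P_def)
    \<comment> \<open>The first \<open>2 * K\<close> entries are distinct, so the trace determines
      which pair was isolated.\<close>
    moreover have "P i \<inter> P j = {}" if "i < K" "j < K" "i \<noteq> j" for i j
    proof -
      have "zs ! i \<notin> {zs ! j, zs ! (K + j)}" using ne that by auto
      then show ?thesis by (auto simp: P_def)
    qed
    ultimately have "sum (binomial_weight p V)
        {S \<in> Pow V. \<exists>i<K. S \<inter> set zs = {zs ! i, zs ! (K + i)}}
      = (\<Sum>i<K. sum (binomial_weight p V) (P i))"
      using V(1) by (simp only:) (intro sum.UNION_disjoint, auto simp: P_def)
    also have "\<dots> \<ge> (\<Sum>i<K. 1 / (3 * (real (3 * K) + 1)\<^sup>2))"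
    proof (intro sum_mono)
      fix i assume i: "i \<in> {..<K}"
      show "1 / (3 * (real (3 * K) + 1)\<^sup>2) \<le> sum (binomial_weight p V) (P i)"
        unfolding p_def P_def
      proof (intro sum_binomial_weight_pair_ge V(1) zs(1))
        show "card (set zs) \<le> 3 * K + 2" using card_length[of zs] zs(2) by simp
      qed (use i ne zs in auto)
    qed
    also have "(\<Sum>i<K. 1 / (3 * (real (3 * K) + 1)\<^sup>2)) \<ge> q"
    proof -
      have "(real (3 * K) + 1)\<^sup>2 \<le> (4 * real K)\<^sup>2" using K by (intro power_mono) auto
      then have "1 * (3 * (real (3 * K) + 1)\<^sup>2) \<le> real K * (48 * real K)"
        by (simp add: power2_eq_square)
      then show ?thesis using K unfolding q_def
        by (subst divide_le_eq) (auto simp: field_simps)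
    qed
    finally show ?thesis by simp
  qed
  have "\<exists>qs. real (length qs) \<le> ln N / q + 2 \<and> set qs \<subseteq> Pow V \<and>
      (\<forall>zs\<in>R. \<exists>S \<in> set qs. \<exists>i<K. S \<inter> set zs = {zs ! i, zs ! (K + i)})"
  proof (rule short_weighted_cover[where w = "binomial_weight p V"])
    show "sum (binomial_weight p V) (Pow V) = 1" using V by (simp add: binomial_weight_total)
    show "1 \<le> N" using V unfolding N_def by (intro one_le_power) simp
    show "0 < q" "q \<le> 1" using K by (auto simp: q_def)
  qed (use V p R hit in \<open>auto simp: binomial_weight_nonneg\<close>)
  then obtain qs where qs: "real (length qs) \<le> ln N / q + 2" "set qs \<subseteq> Pow V"
    "\<forall>zs\<in>R. \<exists>S \<in> set qs. \<exists>i<K. S \<inter> set zs = {zs ! i, zs ! (K + i)}" by blast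
  define L where "L = ln (real (card V))"
  have L: "2 / 3 \<le> L" using ln_nat_ge[OF V(2)] by (simp add: L_def)
  have "ln N / q = 48 * real K * (real (3 * K) + 1) * L"
    using V K unfolding N_def q_def L_def by (subst ln_realpow) auto
  also have "\<dots> \<le> 48 * real K * (4 * real K) * L"
    using K L by (intro mult_right_mono mult_left_mono) auto
  finally have "ln N / q \<le> 192 * ((real K)\<^sup>2 * L)" by (simp add: power2_eq_square)
  \<comment> \<open>The additive 2 is at most \<open>3 * L\<close>, hence at most
    \<open>3 * K\<^sup>2 * L\<close>; so \<open>195 = 192 + 3\<close>.\<close>
  moreover have "1 * L \<le> (real K)\<^sup>2 * L" using K L by (intro mult_right_mono) auto
  ultimately have "real (length qs) \<le> 195 * (real K)\<^sup>2 * L" using qs(1) L by linarith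
  then show ?thesis using qs unfolding isolates_matchings_def R_def L_def by blast
qed

section \<open>Reading the edges off a degenerate supergraph\<close>

lemma degenerate_order:
  assumes "finite V" "degenerate D V H"
  shows "\<exists>f :: 'a \<Rightarrow> nat. inj_on f V \<and> (\<forall>x\<in>V. card {y \<in> V. {x, y} \<in> H \<and> f x < f y} \<le> D)"
  using assms
proof (induction "card V" arbitrary: V)
  case 0
  then show ?case by auto
next
  case (Suc n)
  then have "V \<noteq> {}" by auto
  then obtain u where u: "u \<in> V" "card {v \<in> V. {u, v} \<in> H} \<le> D"
    using Suc.prems unfolding degenerate_def by blast
  have n: "n = card (V - {u})" using Suc.hyps(2) u(1) by simp
  have "degenerate D (V - {u}) H" using Suc.prems(2) unfolding degenerate_def by blast
  then obtain f :: "'a \<Rightarrow> nat" where f: "inj_on f (V - {u})"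
    "\<forall>x\<in>V - {u}. card {y \<in> V - {u}. {x, y} \<in> H \<and> f x < f y} \<le> D"
    using Suc.hyps(1)[OF n finite_Diff[OF Suc.prems(1)]] by blast
  \<comment> \<open>The removed vertex has degree at most \<open>D\<close> and is ranked below all
    others, so all its neighbours may count as upward ones; the rest keep their order.\<close>
  define g where "g x = (if x = u then 0 else Suc (f x))" for x
  have "inj_on g V"
  proof (rule inj_onI)
    fix x y assume "x \<in> V" "y \<in> V" "g x = g y"
    then show "x = y" using inj_onD[OF f(1), of x y] by (auto simp: g_def split: if_splits)
  qed
  moreover have "card {y \<in> V. {x, y} \<in> H \<and> g x < g y} \<le> D" if "x \<in> V" for x
  proof (cases "x = u")
    case True
    have "{y \<in> V. {x, y} \<in> H \<and> g x < g y} \<subseteq> {v \<in> V. {u, v} \<in> H}"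
      unfolding True by blast
    then have "card {y \<in> V. {x, y} \<in> H \<and> g x < g y} \<le> card {v \<in> V. {u, v} \<in> H}"
      by (rule card_mono[rotated]) (simp add: Suc.prems(1))
    then show ?thesis using u by simp
  next
    case False
    then have "{y \<in> V. {x, y} \<in> H \<and> g x < g y} = {y \<in> V - {u}. {x, y} \<in> H \<and> f x < f y}"
      by (auto simp: g_def)
    then show ?thesis using f(2) False that by simp
  qed
  ultimately show ?case by blast
qed

text \<open>The quantifier over all \<open>E\<close> lets the list be chosen from \<open>H\<close>
  alone, so that a single round suffices.\<close>

definition resolves :: "'a set \<Rightarrow> 'a set set \<Rightarrow> 'a set list \<Rightarrow> bool" where
  "resolves V H qs \<longleftrightarrow> (\<forall>E. E \<subseteq> H \<longrightarrow> unsplit (cc_oracle E) qs H = E)"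

text \<open>The vertices whose increasing chain leads to \<open>u\<close> form a set that only the edge from \<open>u\<close> to \<open>v\<close>
  can leave.\<close>

lemma ordered_forest_bridge:
  fixes f :: "'a \<Rightarrow> nat"
  assumes inj: "inj_on f S" and E: "E \<subseteq> H"
    and out: "\<And>x y z. x \<in> S \<Longrightarrow> y \<in> S \<Longrightarrow> z \<in> S \<Longrightarrow> {x, y} \<in> H \<Longrightarrow> {x, z} \<in> H \<Longrightarrow>
      f x < f y \<Longrightarrow> f x < f z \<Longrightarrow> y = z"
    and uv: "u \<in> S" "v \<in> S" "{u, v} \<in> H" "f u < f v" and con: "(u, v) \<in> (induced_adj E S)\<^sup>*"
  shows "{u, v} \<in> E"
proof (rule ccontr)
  assume nE: "{u, v} \<notin> E"
  define r where "r = {(x, y). x \<in> S \<and> y \<in> S \<and> {x, y} \<in> H \<and> f x < f y}"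
  have up: "f x \<le> f y" if "(x, y) \<in> r\<^sup>*" for x y
    using that by (induction rule: rtrancl_induct) (auto simp: r_def)
  have "v \<in> {x. (x, u) \<in> r\<^sup>*}"
    using con
  proof (rule rtrancl_closed)
    fix x y assume x: "x \<in> {x. (x, u) \<in> r\<^sup>*}" and xy: "(x, y) \<in> induced_adj E S"
    have e: "x \<in> S" "y \<in> S" "{x, y} \<in> E" using xy by (auto simp: induced_adj_def)
    show "y \<in> {x. (x, u) \<in> r\<^sup>*}"
    proof (cases "f x < f y")
      case True
      show ?thesis
      proof (cases "x = u")
        case xu: True
        then have "y = v" using out[of u y v] e uv True E by blast
        then show ?thesis using e nE xu by simp
      next
        case False
        then obtain z where z: "(x, z) \<in> r" "(z, u) \<in> r\<^sup>*" using x by (auto elim: converse_rtranclE)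
        then have "y = z" using out[of x y z] e True E by (auto simp: r_def)
        then show ?thesis using z by simp
      qed
    next
      case False
      show ?thesis
      proof (cases "x = y")
        case False
        then have "f x \<noteq> f y" using inj e by (auto simp: inj_on_def)
        then have "(y, x) \<in> r"
          using \<open>\<not> f x < f y\<close> e E by (auto simp: r_def insert_commute)
        then show ?thesis using x by (auto intro: converse_rtrancl_into_rtrancl)
      qed (use x in simp)
    qed
  qed simp
  then show False using up[of v u] uv(4) by simp
qed

lemma resolves_exists:
  assumes V: "finite V" "2 \<le> card V" and K: "0 < K" and H: "H \<subseteq> pairs V" "degenerate (5 * K) V H"
  shows "\<exists>qs. resolves V H qs \<and> set qs \<subseteq> Pow V \<and>
    real (length qs) \<le> 729 * (real K)\<^sup>2 * ln (real (card V))"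
proof -
  obtain f :: "'a \<Rightarrow> nat" where f: "inj_on f V"
    "\<forall>x\<in>V. card {y \<in> V. {x, y} \<in> H \<and> f x < f y} \<le> 5 * K"
    using degenerate_order[OF V(1) H(2)] by blast
  define out where "out x = {y \<in> V. {x, y} \<in> H \<and> f x < f y}" for x
  define R where "R = {(u, v). u \<in> V \<and> v \<in> out u}"
  \<comment> \<open>If a query meets \<open>W (u, v)\<close> only in the pair, then inside it
    \<open>u\<close> has just the out-neighbour \<open>v\<close> and \<open>v\<close> has none, so
    both survive trimming.\<close>
  define W where "W = (\<lambda>(u, v). {u, v} \<union> out u \<union> out v)"
  \<comment> \<open>Trimming leaves outdegree at most one, as \<open>ordered_forest_bridge\<close>
    requires.\<close>
  define trim where "trim S = {x \<in> S. card (out x \<inter> S) \<le> 1}" for S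
  define p where "p = 1 / (real (10 * K) + 1)"
  define q where "q = 1 / (3 * (real (10 * K) + 1)\<^sup>2)"
  have p: "0 \<le> p" "p \<le> 1" by (auto simp: p_def)
  have R_sub: "R \<subseteq> V \<times> V" by (auto simp: R_def out_def)
  have R: "finite R" "real (card R) \<le> real (card V) ^ 2"
  proof -
    show "finite R" using V by (intro finite_subset[OF R_sub]) simp
    have "card R \<le> card V ^ 2"
      using card_mono[OF _ R_sub] V by (simp add: card_cartesian_product power2_eq_square)
    then show "real (card R) \<le> real (card V) ^ 2" by (metis of_nat_le_iff of_nat_power)
  qed
  have hit: "q \<le> sum (binomial_weight p V) {S \<in> Pow V. S \<inter> W e = {fst e, snd e}}" if eR: "e \<in> R" for e
  proof -
    obtain u v where e: "e = (u, v)" by fastforce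
    have uv: "u \<in> V" "v \<in> V" "v \<in> out u" "u \<noteq> v" using eR e by (auto simp: R_def out_def)
    have "card ({u, v} \<union> out u \<union> out v) \<le> card {u, v} + card (out u) + card (out v)"
      by (meson card_Un_le le_trans add_le_mono1)
    then have "card (W e) \<le> 10 * K + 2"
      using bspec[OF f(2) uv(1)] bspec[OF f(2) uv(2)] uv(4) by (simp add: W_def e out_def)
    then show ?thesis
      unfolding p_def q_def e fst_conv snd_conv using V uv
      by (intro sum_binomial_weight_pair_ge) (auto simp: W_def out_def)
  qed
  have "\<exists>qs. real (length qs) \<le> ln (real (card V) ^ 2) / q + 2 \<and> set qs \<subseteq> Pow V \<and>
      (\<forall>e\<in>R. \<exists>S \<in> set qs. S \<inter> W e = {fst e, snd e})"
  proof (rule short_weighted_cover[where w = "binomial_weight p V"])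
    show "sum (binomial_weight p V) (Pow V) = 1" using V by (simp add: binomial_weight_total)
    show "1 \<le> real (card V) ^ 2" using V by (intro one_le_power) simp
    show "0 < q" by (auto simp: q_def)
    have le_one: "1 / (3 * c) \<le> 1" if "1 \<le> c" for c :: real using that by simp
    show "q \<le> 1" unfolding q_def by (intro le_one one_le_power) simp
  qed (use V p R hit in \<open>auto simp: binomial_weight_nonneg\<close>)
  then obtain Rs where Rs: "real (length Rs) \<le> ln (real (card V) ^ 2) / q + 2" "set Rs \<subseteq> Pow V"
    and cover: "\<forall>e\<in>R. \<exists>S \<in> set Rs. S \<inter> W e = {fst e, snd e}" by blast
  have "unsplit (cc_oracle E) (map trim Rs) H = E" if E: "E \<subseteq> H" for E
  proof
    show "E \<subseteq> unsplit (cc_oracle E) (map trim Rs) H"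
      using E H(1) by (intro subset_unsplit) auto
    show "unsplit (cc_oracle E) (map trim Rs) H \<subseteq> E"
    proof
      fix e assume e: "e \<in> unsplit (cc_oracle E) (map trim Rs) H"
      have eH: "e \<in> H" using e by (simp add: unsplit_def)
      then obtain a b where ab: "e = {a, b}" "a \<in> V" "b \<in> V" "a \<noteq> b"
        using H by (auto simp: pairs_def)
      have "f a \<noteq> f b" using f(1) ab by (simp add: inj_on_eq_iff)
      moreover have "e = {b, a}" using ab(1) by blast
      ultimately obtain u v where uv: "e = {u, v}" "u \<in> V" "v \<in> V" "f u < f v"
        using that[OF ab(1-3)] that[of b a] ab(2,3) by linarith
      then have "(u, v) \<in> R" using eH by (auto simp: R_def out_def)
      then obtain S where S: "S \<in> set Rs" "S \<inter> W (u, v) = {u, v}" using bspec[OF cover, of "(u, v)"] by auto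
      have SV: "S \<subseteq> V" using S(1) Rs(2) by blast
      have "out u \<inter> S \<subseteq> {u, v}" "out v \<inter> S \<subseteq> {u, v}"
        using S(2) by (auto simp: W_def)
      moreover have "u \<notin> out u" "u \<notin> out v" "v \<notin> out v"
        using uv(4) by (simp_all add: out_def)
      ultimately have "out u \<inter> S \<subseteq> {v}" "out v \<inter> S \<subseteq> {}" by blast+
      then have "card (out u \<inter> S) \<le> card {v}" "card (out v \<inter> S) \<le> card ({} :: 'a set)"
        by (intro card_mono; simp)+
      then have t: "u \<in> trim S" "v \<in> trim S"
        using S(2) by (auto simp: trim_def)
      have "trim S \<in> set (map trim Rs)" using S(1) by simp
      then have "\<exists>c\<in>cc_oracle E (trim S). {u, v} \<subseteq> c"
        using e t uv(1) unfolding unsplit_def by blast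
      then have con: "(u, v) \<in> (induced_adj E (trim S))\<^sup>*" unfolding cc_oracle_joins_iff by blast
      have "{u, v} \<in> E"
      proof (rule ordered_forest_bridge[OF _ E _ t _ uv(4) con])
        show "inj_on f (trim S)" by (rule inj_on_subset[OF f(1)]) (use SV in \<open>auto simp: trim_def\<close>)
        show "{u, v} \<in> H" using eH uv by simp
        fix x y z
        assume *: "x \<in> trim S" "y \<in> trim S" "z \<in> trim S" "{x, y} \<in> H" "{x, z} \<in> H"
          "f x < f y" "f x < f z"
        have "finite (out x \<inter> S)" using V by (simp add: out_def)
        moreover have "y \<in> out x \<inter> S" "z \<in> out x \<inter> S"
          using * SV by (auto simp: trim_def out_def)
        moreover have "card (out x \<inter> S) \<le> 1" using *(1) by (simp add: trim_def)
        ultimately show "y = z" using card_le_Suc0_iff_eq[of "out x \<inter> S"] by simp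
      qed
      then show "e \<in> E" using uv by simp
    qed
  qed
  then have "resolves V H (map trim Rs)" by (simp add: resolves_def)
  moreover have "set (map trim Rs) \<subseteq> Pow V" using Rs(2) by (auto simp: trim_def)
  moreover have "real (length (map trim Rs)) \<le> 729 * (real K)\<^sup>2 * ln (real (card V))"
  proof -
    define L where "L = ln (real (card V))"
    have L: "2 / 3 \<le> L" using ln_nat_ge[OF V(2)] by (simp add: L_def)
    \<comment> \<open>The factor 6 below is 2 from the squared count times 3 from \<open>q\<close>;
      with 3 more for the additive 2 this yields \<open>729 = 6 * 121 + 3\<close>.\<close>
    have "(real (10 * K) + 1)\<^sup>2 \<le> (11 * real K)\<^sup>2" using K by (intro power_mono) auto
    then have *: "(real (10 * K) + 1)\<^sup>2 \<le> 121 * (real K)\<^sup>2" by (simp add: power_mult_distrib)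
    have "ln (real (card V) ^ 2) / q = 6 * ((real (10 * K) + 1)\<^sup>2 * L)"
      using V unfolding q_def L_def by (subst ln_realpow) auto
    also have "\<dots> \<le> 6 * ((121 * (real K)\<^sup>2) * L)"
      using * L by (intro mult_right_mono mult_left_mono) auto
    finally have "ln (real (card V) ^ 2) / q \<le> 726 * ((real K)\<^sup>2 * L)" by simp
    moreover have "1 * L \<le> (real K)\<^sup>2 * L" using K L by (intro mult_right_mono) auto
    ultimately have "real (length Rs) \<le> 729 * (real K)\<^sup>2 * L" using Rs(1) L by linarith
    then show ?thesis by (simp add: L_def)
  qed
  ultimately show ?thesis by blast
qed

subsection \<open>The doubling strategy\<close>

text \<open>Choosing the list from \<open>V\<close> and \<open>K\<close> alone keeps the strategy
  deterministic and independent of the hidden graph.\<close>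

definition matching_queries :: "'a set \<Rightarrow> nat \<Rightarrow> 'a set list" where
  "matching_queries V K = (SOME qs. isolates_matchings K V qs \<and> set qs \<subseteq> Pow V \<and>
     real (length qs) \<le> 195 * (real K)\<^sup>2 * ln (real (card V)))"

definition resolving_queries :: "'a set \<Rightarrow> nat \<Rightarrow> 'a set set \<Rightarrow> 'a set list" where
  "resolving_queries V K H = (SOME qs. resolves V H qs \<and> set qs \<subseteq> Pow V \<and>
     real (length qs) \<le> 729 * (real K)\<^sup>2 * ln (real (card V)))"

lemma matching_queries:
  assumes "finite V" "2 \<le> card V" "0 < K"
  shows "isolates_matchings K V (matching_queries V K)"
    and "set (matching_queries V K) \<subseteq> Pow V"
    and "real (length (matching_queries V K)) \<le> 195 * (real K)\<^sup>2 * ln (real (card V))"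
  using someI_ex[OF isolates_matchings_exists[OF assms]]
  unfolding matching_queries_def[symmetric] by blast+

lemma resolving_queries:
  assumes "finite V" "2 \<le> card V" "0 < K" "H \<subseteq> pairs V" "degenerate (5 * K) V H"
  shows "resolves V H (resolving_queries V K H)"
    and "set (resolving_queries V K H) \<subseteq> Pow V"
    and "real (length (resolving_queries V K H)) \<le> 729 * (real K)\<^sup>2 * ln (real (card V))"
  using someI_ex[OF resolves_exists[OF assms]]
  unfolding resolving_queries_def[symmetric] by blast+

text \<open>Turns recorded answers back into an oracle. Outside \<open>qs\<close> its value is
  unspecified, but \<open>unsplit\<close> consults it only on \<open>qs\<close>.\<close>

definition lookup :: "'a set list \<Rightarrow> 'a set set list \<Rightarrow> 'a set \<Rightarrow> 'a set set" where
  "lookup qs answers S = the (map_of (zip qs answers) S)"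

lemma unsplit_lookup: "unsplit (lookup qs (map orc qs)) qs H = unsplit orc qs H"
  by (auto simp: unsplit_def lookup_def map_of_zip_map)

text \<open>The fuel only makes the recursion primitive: it never runs out when it exceeds \<open>card V\<close>.\<close>

primrec search :: "nat \<Rightarrow> 'a set \<Rightarrow> nat \<Rightarrow> 'a strategy" where
  "search 0 V j = Output {}"
| "search (Suc fuel) V j = Round (matching_queries V (2 ^ j)) (\<lambda>answers.
     let H = unsplit (lookup (matching_queries V (2 ^ j)) answers) (matching_queries V (2 ^ j)) (pairs V)
     in if degenerate (5 * 2 ^ j) V H
        then Round (resolving_queries V (2 ^ j) H) (\<lambda>answers'.
          Output (unsplit (lookup (resolving_queries V (2 ^ j) H) answers') (resolving_queries V (2 ^ j) H) H))
        else search fuel V (Suc j))"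

text \<open>The guess \<open>2 ^ i\<close> costs at most \<open>(195 + 729) * 4 ^ i\<close> times
  the logarithm, and the sum over \<open>i\<close> from \<open>j\<close> to \<open>J\<close> is
  geometric. Each guess takes one round and the resolving list one more.\<close>

lemma search_correct:
  assumes G: "simple_graph V E" and n: "2 \<le> card V" and tw: "treewidth V E \<le> 2 ^ J"
    and "j \<le> J" "J < j + fuel"
  shows "result (cc_oracle E) (search fuel V j) = E \<and>
    set (queries (cc_oracle E) (search fuel V j)) \<subseteq> Pow V \<and>
    real (length (queries (cc_oracle E) (search fuel V j)))
      \<le> 924 * (2 * 4 ^ J - 4 ^ j) * ln (real (card V)) \<and>
    rounds (cc_oracle E) (search fuel V j) + j \<le> J + 2"
  using assms(4,5)
proof (induction fuel arbitrary: j)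
  case 0
  then show ?case by simp
next
  case (Suc fuel)
  define K :: nat where "K = 2 ^ j"
  define qs where "qs = matching_queries V K"
  define H where "H = unsplit (cc_oracle E) qs (pairs V)"
  define rs where "rs = resolving_queries V K H"
  define L where "L = ln (real (card V))"
  have V: "finite V" and EV: "E \<subseteq> pairs V" using G by (auto simp: simple_graph_def pairs_def)
  have K: "0 < K" "(real K)\<^sup>2 = 4 ^ j"
    by (auto simp: K_def power_mult[symmetric] mult.commute[of _ 2] power_mult)
  have L: "0 \<le> L" using n by (simp add: L_def)
  have qs: "isolates_matchings K V qs" "set qs \<subseteq> Pow V" "real (length qs) \<le> 195 * 4 ^ j * L"
    using matching_queries[OF V n K(1)] K by (auto simp: qs_def L_def)
  have HV: "H \<subseteq> pairs V" by (auto simp: H_def unsplit_def)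
  have step: "search (Suc fuel) V j = Round qs (\<lambda>answers.
     let H = unsplit (lookup qs answers) qs (pairs V)
     in if degenerate (5 * K) V H
        then Round (resolving_queries V K H) (\<lambda>answers'.
          Output (unsplit (lookup (resolving_queries V K H) answers') (resolving_queries V K H) H))
        else search fuel V (Suc j))"
    by (simp only: search.simps qs_def K_def)
  show ?case
  proof (cases "degenerate (5 * K) V H")
    case True
    have rs: "resolves V H rs" "set rs \<subseteq> Pow V" "real (length rs) \<le> 729 * 4 ^ j * L"
      using resolving_queries[OF V n K(1) HV True] K by (auto simp: rs_def L_def)
    have "E \<subseteq> H" unfolding H_def using EV by (intro subset_unsplit) auto
    then have "unsplit (cc_oracle E) rs H = E" using rs(1) unfolding resolves_def by blast
    moreover have "(4::real) ^ j \<le> 4 ^ J" using Suc.prems by (intro power_increasing) auto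
    then have "(924 * 4 ^ j) * L \<le> 924 * (2 * 4 ^ J - 4 ^ j) * L"
      using L by (intro mult_right_mono) auto
    then have "real (length qs + length rs) \<le> 924 * (2 * 4 ^ J - 4 ^ j) * L"
      using qs(3) rs(3) by (simp add: algebra_simps)
    ultimately show ?thesis
      using True qs rs Suc.prems unfolding step
      by (simp add: unsplit_lookup H_def[symmetric] rs_def[symmetric] L_def[symmetric] Let_def)
  next
    case False
    \<comment> \<open>At \<open>j = J\<close> the guess is at least the treewidth, so the degeneracy
      test could not have failed.\<close>
    have "j \<noteq> J"
      using False degenerate_unsplit[OF G _ K(1) qs(1)] tw by (auto simp: H_def K_def)
    then have j: "Suc j \<le> J" "J < Suc j + fuel" using Suc.prems by auto
    note IH = Suc.IH[OF j, folded L_def]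
    have "195 * 4 ^ j * L + 924 * (2 * 4 ^ J - 4 ^ Suc j) * L \<le> 924 * (2 * 4 ^ J - 4 ^ j) * L"
      using L by (simp add: algebra_simps)
    then have "real (length qs) + real (length (queries (cc_oracle E) (search fuel V (Suc j))))
        \<le> 924 * (2 * 4 ^ J - 4 ^ j) * L"
      using qs(3) IH by linarith
    then show ?thesis
      using False IH qs unfolding step
      by (simp add: unsplit_lookup H_def[symmetric] L_def[symmetric] Let_def)
  qed
qed

text \<open>For a single vertex the logarithm in the budget vanishes and no query is allowed, so
  trivial graphs are answered outright.\<close>

definition reconstruct :: "'a set \<Rightarrow> 'a strategy" where
  "reconstruct V = (if card V \<le> 1 then Output {} else search (Suc (card V)) V 0)"

lemma reconstruct_correct:
  assumes G: "simple_graph V E"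
  shows "within_budget 7392 2 V E (reconstruct V) \<and> result (cc_oracle E) (reconstruct V) = E"
proof (cases "card V \<le> 1")
  case True
  have "E = {}"
  proof (rule equals0I)
    fix e assume "e \<in> E"
    then obtain u v where "u \<in> V" "v \<in> V" "u \<noteq> v" using G by (auto simp: simple_graph_def)
    then show False using True G card_le_Suc0_iff_eq[of V] by (auto simp: simple_graph_def)
  qed
  moreover have "card V = 0 \<or> card V = 1" using True by linarith
  ultimately show ?thesis using True by (auto simp: reconstruct_def within_budget_def)
next
  case False
  then have n: "2 \<le> card V" by simp
  define k where "k = treewidth V E"
  define J where "J = (LEAST J. k \<le> 2 ^ J)"
  \<comment> \<open>This gives \<open>J \<le> card V\<close>, so the fuel
    \<open>Suc (card V)\<close> lasts until the guess \<open>2 ^ J\<close>.\<close>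
  have "k \<le> 2 ^ card V"
    using treewidth_le_card[OF G] less_exp[of "card V"] unfolding k_def by linarith
  then have J: "k \<le> 2 ^ J" "J \<le> card V"
    unfolding J_def by (rule LeastI, rule Least_le)
  \<comment> \<open>By minimality of \<open>J\<close>, half of \<open>2 ^ J\<close> is still below
    \<open>k\<close>; the \<open>max\<close> covers \<open>J = 0\<close>.\<close>
  have J2: "2 ^ J \<le> 2 * max 1 k"
  proof (cases J)
    case (Suc i)
    then have "\<not> k \<le> 2 ^ i" using not_less_Least[of i "\<lambda>J. k \<le> 2 ^ J"] by (simp add: J_def)
    then show ?thesis using Suc by simp
  qed simp
  define L where "L = ln (real (card V))"
  have L: "0 \<le> L" using n by (simp add: L_def)
  have s: "result (cc_oracle E) (reconstruct V) = E"
      "set (queries (cc_oracle E) (reconstruct V)) \<subseteq> Pow V"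
      "real (length (queries (cc_oracle E) (reconstruct V))) \<le> 924 * (2 * 4 ^ J - 1) * L"
      "rounds (cc_oracle E) (reconstruct V) \<le> J + 2"
    using search_correct[OF G n J(1)[unfolded k_def], of 0 "Suc (card V)"] J(2) n
    unfolding reconstruct_def L_def by (auto simp del: search.simps)
  have "(2::real) ^ J \<le> 2 * real (max 1 k)"
    using of_nat_mono[OF J2, where 'a = real] by simp
  then have J_sq: "((2::real) ^ J)\<^sup>2 \<le> (2 * real (max 1 k))\<^sup>2" by (rule power_mono) simp
  have "(4::real) ^ J = (2 ^ J)\<^sup>2" by (simp add: power_mult[symmetric] mult.commute[of _ 2] power_mult)
  also have "\<dots> \<le> (2 * real (max 1 k))\<^sup>2"
    by (rule J_sq)
  also have "\<dots> = 4 * real (max 1 k) ^ 2" unfolding power_mult_distrib by simp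
  finally have "(4::real) ^ J \<le> 4 * real (max 1 k) ^ 2" .
  \<comment> \<open>Here \<open>7392 = 924 * 2 * 4\<close>, with 2 from the geometric sum and 4 from
    overshooting \<open>k\<close> by a factor of at most 2.\<close>
  then have "924 * (2 * 4 ^ J - 1) * L \<le> 7392 * real (max 1 k) ^ 2 * L"
    using L by (intro mult_right_mono) auto
  then have q: "real (length (queries (cc_oracle E) (reconstruct V))) \<le> 7392 * real (max 1 k) ^ 2 * L"
    using s(3) by linarith
  define M where "M = real (max 2 k)"
  \<comment> \<open>As \<open>M\<close> is at least 2, squaring absorbs the doubling. This yields
    \<open>J \<le> 3 * ln M\<close>, and the two extra rounds cost at most another
    \<open>3 * ln M\<close>.\<close>
  have "real (2 ^ J) \<le> M\<^sup>2"
  proof -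
    have "2 * max 1 k \<le> max 2 k * max 2 k" by (intro mult_mono) auto
    then have "2 ^ J \<le> max 2 k * max 2 k" using J2 by (rule le_trans[rotated])
    then show ?thesis unfolding M_def power2_eq_square of_nat_mult[symmetric] by (rule of_nat_mono)
  qed
  then have "ln (2 ^ J) \<le> ln (M\<^sup>2)" by (subst ln_le_cancel_iff) (auto simp: M_def)
  then have "real J * ln 2 \<le> 2 * ln M" by (simp add: ln_realpow M_def)
  moreover have "real J * (2 / 3) \<le> real J * ln 2" using ln2_ge_two_thirds by (intro mult_left_mono) auto
  moreover have M: "2 / 3 \<le> ln M" unfolding M_def by (intro ln_nat_ge) simp
  ultimately have "real J + 2 \<le> 7392 * ln M" by linarith
  then have r: "real (rounds (cc_oracle E) (reconstruct V)) \<le> 7392 * ln M" using s(4) by linarith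
  show ?thesis
    unfolding within_budget_def
  proof (intro conjI ballI)
    show "S \<subseteq> V" if "S \<in> set (queries (cc_oracle E) (reconstruct V))" for S
      using that s(2) by blast
  qed (use q r s(1) in \<open>simp_all only: k_def L_def M_def\<close>)
qed

text \<open>Passes from the quadratic bound to the cubic one; the base
  \<open>max 1 (treewidth V E)\<close> is at least 1.\<close>

lemma within_budget_mono:
  assumes "within_budget C d V E s" "d \<le> d'" "0 \<le> C"
  shows "within_budget C d' V E s"
proof -
  have "0 \<le> ln (real (card V))" by (cases "card V") auto
  then have "C * real (max 1 (treewidth V E)) ^ d * ln (real (card V))
      \<le> C * real (max 1 (treewidth V E)) ^ d' * ln (real (card V))"
    using assms(2-) by (intro mult_right_mono mult_left_mono power_increasing) auto
  then show ?thesis using assms(1) unfolding within_budget_def by linarith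
qed

theorem theorem7:
  "(\<exists>(A :: nat set \<Rightarrow> nat strategy pmf) (C :: real) (p :: nat \<Rightarrow> real).
      p \<longlonglongrightarrow> 1 \<and>
      (\<forall>V E. simple_graph V E \<longrightarrow>
         (\<forall>s \<in> set_pmf (A V). within_budget C 2 V E s) \<and>
         measure_pmf.prob (A V) {s. result (cc_oracle E) s = E} \<ge> p (card V)))
   \<and>
   (\<exists>(A :: nat set \<Rightarrow> nat strategy) (C :: real).
      \<forall>V E. simple_graph V E \<longrightarrow>
         within_budget C 3 V E (A V) \<and> result (cc_oracle E) (A V) = E)"
proof (intro conjI)
  show "\<exists>(A :: nat set \<Rightarrow> nat strategy pmf) (C :: real) (p :: nat \<Rightarrow> real).
      p \<longlonglongrightarrow> 1 \<and>
      (\<forall>V E. simple_graph V E \<longrightarrow>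
         (\<forall>s \<in> set_pmf (A V). within_budget C 2 V E s) \<and>
         measure_pmf.prob (A V) {s. result (cc_oracle E) s = E} \<ge> p (card V))"
    \<comment> \<open>A point mass on \<open>reconstruct V\<close> serves as the randomized
      algorithm, with success probability 1 on every graph.\<close>
    using reconstruct_correct
    by (intro exI[of _ "\<lambda>V. return_pmf (reconstruct V)"] exI[of _ 7392] exI[of _ "\<lambda>_. 1"]) auto
  have "within_budget 7392 3 V E (reconstruct V)" if "simple_graph V E" for V :: "nat set" and E
    by (rule within_budget_mono[OF conjunct1[OF reconstruct_correct[OF that]]]) simp_all
  then show "\<exists>(A :: nat set \<Rightarrow> nat strategy) (C :: real).
      \<forall>V E. simple_graph V E \<longrightarrow>
         within_budget C 3 V E (A V) \<and> result (cc_oracle E) (A V) = E"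
    using reconstruct_correct by (intro exI[of _ reconstruct] exI[of _ 7392]) blast
qed

end
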